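(* Let $(H,\langle\cdot,\cdot\rangle)$ be an inner product space over $\mathbb{K}$ ($\mathbb{K}=\mathbb{R}$ or $\mathbb{C}$), let $\{e_i\}_{i\in I}$ be a family of orthonormal vectors in $H$, let $F$ be a finite subset of $I$, and let $\phi_i,\Phi_i\in\mathbb{K}$ $(i\in F)$ be such that $\sum_{i\in F}\operatorname{Re}(\Phi_i\overline{\phi_i})>0$. Let $x\in H$ be such that either (i) $\operatorname{Re}\left\langle \sum_{i\in F}\Phi_i e_i-x,\;x-\sum_{i\in F}\phi_i e_i\right\rangle\ge 0$, or (equivalently) (ii) $\left\|x-\sum_{i\in F}\frac{\phi_i+\Phi_i}{2}e_i\right\|\le \frac12\left(\sum_{i\in F}|\Phi_i-\phi_i|^2\right)^{1/2}$ holds. Then $$0\le \|x\|^2-\sum_{i\in F}|\langle x,e_i\rangle|^2\le \frac14 M^2(\mathbf{\Phi},\mathbf{\phi},F)\sum_{i\in F}|\langle x,e_i\rangle|^2,$$ where $$M(\mathbf{\Phi},\mathbf{\phi},F):=\left[\frac{\sum_{i\in F}\left\{(|\Phi_i|-|\phi_i|)^2+4\left[|\Phi_i\overline{\phi_i}|-\operatorname{Re}(\Phi_i\overline{\phi_i})\right]\right\}}{\sum_{i\in F}\operatorname{Re}(\Phi_i\overline{\phi_i})}\right]^{1/2}.$$ The constant $\frac14$ is best possible: there is no $c<\frac14$ such that the second inequality with $c$ in place of $\frac14$ holds for all $H$, $\{e_i\}_{i\in I}$, $F$, $\phi_i,\Phi_i$ and $x$ satisfying the hypotheses.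
   Context: The inner product is linear in the first argument and conjugate-linear in the second, and $\|x\|=\langle x,x\rangle^{1/2}$. A family $\{e_i\}_{i\in I}$ is orthonormal if $\langle e_i,e_j\rangle=0$ for $i\neq j$ and $\|e_i\|=1$ for all $i\in I$. $M^2(\cdot)$ denotes the square of $M(\cdot)$. *)

theory Defs
  imports "HOL-Analysis.Inner_Product" "HOL-Library.Product_Plus"
begin

(* The scalar field K, which is R or C: a real normed field with an isometric embedding into
   the complex numbers whose image is R or all of C.  The two instances are the types real
   and complex; every other instance is isometrically isomorphic to one of them. *)
class real_or_complex = real_normed_field +
  fixes emb :: "'a \<Rightarrow> complex"
  assumes emb_add: "emb (a + b) = emb a + emb b"
    and emb_mult: "emb (a * b) = emb a * emb b"
    and emb_one: "emb 1 = 1"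
    and emb_scaleR: "emb (r *\<^sub>R a) = r *\<^sub>R emb a"
    and norm_emb: "norm (emb a) = norm a"
    and range_emb: "range emb = \<real> \<or> range emb = UNIV"

instantiation real :: real_or_complex
begin
definition emb_real :: "real \<Rightarrow> complex" where "emb_real = complex_of_real"
instance
  by standard (auto simp: emb_real_def Reals_def scaleR_conv_of_real)
end

instantiation complex :: real_or_complex
begin
definition emb_complex :: "complex \<Rightarrow> complex" where "emb_complex = (\<lambda>z. z)"
instance
  by standard (auto simp: emb_complex_def)
end

definition sc_Re :: "'k::real_or_complex \<Rightarrow> real" where
  "sc_Re a = Re (emb a)"

(* Well defined because emb is injective and its image is closed under conjugation. *)
definition sc_cnj :: "'k::real_or_complex \<Rightarrow> 'k" where
  "sc_cnj a = inv emb (cnj (emb a))"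

lemma inj_emb: "inj (emb :: 'k::real_or_complex \<Rightarrow> complex)"
proof (rule injI)
  fix a b :: 'k
  assume "emb a = emb b"
  moreover have "emb a = emb (a - b) + emb b"
    using emb_add[of "a - b" b] by simp
  ultimately have "norm (a - b) = 0"
    using norm_emb[of "a - b"] by simp
  then show "a = b" by simp
qed

lemma emb_sc_cnj: "emb (sc_cnj a) = cnj (emb a)"
proof -
  have "cnj (emb a) \<in> range (emb :: 'a \<Rightarrow> complex)"
    using range_emb[where 'a = 'a] by (metis Reals_cnj_iff UNIV_I rangeI)
  then show ?thesis
    unfolding sc_cnj_def by (rule f_inv_into_f)
qed

lemma sc_Re_real: "sc_Re (a::real) = a"
  by (simp add: sc_Re_def emb_real_def)

lemma sc_cnj_real: "sc_cnj (a::real) = a"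
  using emb_sc_cnj[of a] by (simp add: emb_real_def)

lemma sc_Re_complex: "sc_Re (a::complex) = Re a"
  by (simp add: sc_Re_def emb_complex_def)

lemma sc_cnj_complex: "sc_cnj (a::complex) = cnj a"
  using emb_sc_cnj[of a] by (simp add: emb_complex_def)

(* By ip_conj the value ip x x is real, so the order condition may be read off its real part. *)
locale inner_product_space = vector_space scale
  for scale :: "'k::real_or_complex \<Rightarrow> 'v::ab_group_add \<Rightarrow> 'v" +
  fixes ip :: "'v \<Rightarrow> 'v \<Rightarrow> 'k"
  assumes ip_add_left: "ip (x + y) z = ip x z + ip y z"
    and ip_scale_left: "ip (scale a x) y = a * ip x y"
    and ip_conj: "ip y x = sc_cnj (ip x y)"
    and ip_ge_0: "0 \<le> sc_Re (ip x x)"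
    and ip_eq_0_iff: "ip x x = 0 \<longleftrightarrow> x = 0"

definition ip_norm :: "('v \<Rightarrow> 'v \<Rightarrow> 'k::real_or_complex) \<Rightarrow> 'v \<Rightarrow> real" where
  "ip_norm ip x = sqrt (sc_Re (ip x x))"

(* Real inner product spaces are the inner product spaces of the library. *)
lemma inner_product_space_real_inner:
  "inner_product_space scaleR (inner :: 'v::real_inner \<Rightarrow> 'v \<Rightarrow> real)"
  by unfold_locales
    (auto simp: sc_Re_real sc_cnj_real inner_add_left inner_commute algebra_simps)

lemma ip_norm_real_inner: "ip_norm inner (x::'v::real_inner) = norm x"
  by (simp add: ip_norm_def sc_Re_real norm_eq_sqrt_inner)

lemma inner_product_space_complex:
  "inner_product_space (*) (\<lambda>x y :: complex. x * cnj y)"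
  by unfold_locales (auto simp: sc_Re_complex sc_cnj_complex algebra_simps)

definition orthonormal_family ::
    "('v \<Rightarrow> 'v \<Rightarrow> 'k::real_or_complex) \<Rightarrow> 'i set \<Rightarrow> ('i \<Rightarrow> 'v) \<Rightarrow> bool" where
  "orthonormal_family ip I e \<longleftrightarrow>
     (\<forall>i\<in>I. \<forall>j\<in>I. i \<noteq> j \<longrightarrow> ip (e i) (e j) = 0) \<and> (\<forall>i\<in>I. ip_norm ip (e i) = 1)"

definition cond_inner ::
    "('k::real_or_complex \<Rightarrow> 'v::ab_group_add \<Rightarrow> 'v) \<Rightarrow> ('v \<Rightarrow> 'v \<Rightarrow> 'k) \<Rightarrow> ('i \<Rightarrow> 'v) \<Rightarrow> 'i set
      \<Rightarrow> ('i \<Rightarrow> 'k) \<Rightarrow> ('i \<Rightarrow> 'k) \<Rightarrow> 'v \<Rightarrow> bool" where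
  "cond_inner scale ip e F \<Phi> \<phi> x \<longleftrightarrow>
     sc_Re (ip ((\<Sum>i\<in>F. scale (\<Phi> i) (e i)) - x) (x - (\<Sum>i\<in>F. scale (\<phi> i) (e i)))) \<ge> 0"

definition cond_ball ::
    "('k::real_or_complex \<Rightarrow> 'v::ab_group_add \<Rightarrow> 'v) \<Rightarrow> ('v \<Rightarrow> 'v \<Rightarrow> 'k) \<Rightarrow> ('i \<Rightarrow> 'v) \<Rightarrow> 'i set
      \<Rightarrow> ('i \<Rightarrow> 'k) \<Rightarrow> ('i \<Rightarrow> 'k) \<Rightarrow> 'v \<Rightarrow> bool" where
  "cond_ball scale ip e F \<Phi> \<phi> x \<longleftrightarrow>
     ip_norm ip (x - (\<Sum>i\<in>F. scale ((\<phi> i + \<Phi> i) / 2) (e i)))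
       \<le> 1 / 2 * sqrt (\<Sum>i\<in>F. (norm (\<Phi> i - \<phi> i))\<^sup>2)"

definition bessel_M ::
    "('i \<Rightarrow> 'k::real_or_complex) \<Rightarrow> ('i \<Rightarrow> 'k) \<Rightarrow> 'i set \<Rightarrow> real" where
  "bessel_M \<Phi> \<phi> F =
     sqrt ((\<Sum>i\<in>F. (norm (\<Phi> i) - norm (\<phi> i))\<^sup>2
              + 4 * (norm (\<Phi> i * sc_cnj (\<phi> i)) - sc_Re (\<Phi> i * sc_cnj (\<phi> i))))
           / (\<Sum>i\<in>F. sc_Re (\<Phi> i * sc_cnj (\<phi> i))))"

end

theory Submission imports Defs "HOL-Analysis.Convex" begin

text \<open>
  Write \<open>c\<^sub>i = \<langle>x, e\<^sub>i\<rangle>\<close>, \<open>S = \<Sum>Re (\<Phi>\<^sub>i cnj \<phi>\<^sub>i)\<close>, \<open>A = \<Sum>\<Phi>\<^sub>i e\<^sub>i\<close> and \<open>B = \<Sum>\<phi>\<^sub>i e\<^sub>i\<close>.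
  Conditions (i) and (ii) agree by polarization: \<open>Re \<langle>A - x, x - B\<rangle>\<close> is
  \<open>\<parallel>A - B\<parallel>\<^sup>2 / 4 - \<parallel>x - (A + B)/2\<parallel>\<^sup>2\<close>, and orthonormality turns \<open>\<parallel>A - B\<parallel>\<^sup>2\<close> into
  \<open>\<Sum>\<bar>\<Phi>\<^sub>i - \<phi>\<^sub>i\<bar>\<^sup>2\<close> (lemmas \<open>polarization\<close> and \<open>cond_inner_iff_cond_ball\<close>).

  Expanding the inner product in (i) gives \<open>\<parallel>x\<parallel>\<^sup>2 + S \<le> \<Sum>(Re (\<Phi>\<^sub>i cnj c\<^sub>i) + Re (c\<^sub>i cnj \<phi>\<^sub>i))\<close>, hence
  \<open>\<parallel>x\<parallel>\<^sup>2 + S \<le> \<Sum>(\<bar>\<Phi>\<^sub>i\<bar> + \<bar>\<phi>\<^sub>i\<bar>) \<bar>c\<^sub>i\<bar>\<close>.  Squaring, with the arithmetic-geometric mean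
  inequality \<open>4 S \<parallel>x\<parallel>\<^sup>2 \<le> (\<parallel>x\<parallel>\<^sup>2 + S)\<^sup>2\<close> on the left and the Cauchy-Schwarz inequality on the right,
  yields \<open>4 S \<parallel>x\<parallel>\<^sup>2 \<le> \<Sum>(\<bar>\<Phi>\<^sub>i\<bar> + \<bar>\<phi>\<^sub>i\<bar>)\<^sup>2 \<cdot> \<Sum>\<bar>c\<^sub>i\<bar>\<^sup>2\<close> (lemma \<open>four_mult_norm_le\<close>).
  This is the upper bound, because \<open>M\<^sup>2 + 4 = \<Sum>(\<bar>\<Phi>\<^sub>i\<bar> + \<bar>\<phi>\<^sub>i\<bar>)\<^sup>2 / S\<close> (lemma \<open>bessel_M_square\<close>);
  the lower bound is Bessel's inequality.

  The constant is sharp since equality occurs in the plane, with the single vector \<open>(1, 0)\<close>: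
  for one vector, equality in all the inequalities above means \<open>\<parallel>x\<parallel>\<^sup>2 = S = \<Phi> \<phi>\<close> and
  \<open>c = 2 \<Phi> \<phi> / (\<Phi> + \<phi>)\<close> for positive \<open>\<Phi>\<close> and \<open>\<phi>\<close>; the choice \<open>\<Phi> = 4\<close>, \<open>\<phi> = 1\<close> makes
  \<open>x = (8/5, 6/5)\<close> rational.
\<close>

section \<open>The scalar field\<close>

lemma emb_zero [simp]: "emb 0 = 0"
  using emb_add[of 0 0] by simp

lemma emb_minus: "emb (- a) = - emb a"
  using emb_add[of a "- a"] by (simp add: add_eq_0_iff)

lemma emb_diff: "emb (a - b) = emb a - emb b"
  using emb_add[of a "- b"] by (simp add: emb_minus)

lemma emb_of_real [simp]: "emb (of_real r) = of_real r"
  unfolding of_real_def by (simp add: emb_scaleR emb_one)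

lemma emb_eqI: "emb a = emb b \<Longrightarrow> a = b"
  using inj_emb by (rule injD)

lemma sc_Re_add: "sc_Re (a + b) = sc_Re a + sc_Re b"
  by (simp add: sc_Re_def emb_add)

lemma sc_Re_diff: "sc_Re (a - b) = sc_Re a - sc_Re b"
  by (simp add: sc_Re_def emb_diff)

lemma sc_Re_zero [simp]: "sc_Re 0 = 0"
  by (simp add: sc_Re_def)

lemma sc_Re_sum: "sc_Re (sum f A) = (\<Sum>i\<in>A. sc_Re (f i))"
  by (induction A rule: infinite_finite_induct) (simp_all add: sc_Re_add)

lemma sc_Re_of_real [simp]: "sc_Re (of_real r) = r"
  by (simp add: sc_Re_def)

lemma sc_Re_le_norm: "sc_Re a \<le> norm a"
  unfolding sc_Re_def by (metis complex_Re_le_cmod norm_emb)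

lemma sc_cnj_add: "sc_cnj (a + b) = sc_cnj a + sc_cnj b"
  by (rule emb_eqI, simp add: emb_sc_cnj emb_add)

lemma sc_cnj_mult: "sc_cnj (a * b) = sc_cnj a * sc_cnj b"
  by (rule emb_eqI, simp add: emb_sc_cnj emb_mult)

lemma sc_cnj_sc_cnj [simp]: "sc_cnj (sc_cnj a) = a"
  by (rule emb_eqI, simp add: emb_sc_cnj)

lemma sc_cnj_of_real [simp]: "sc_cnj (of_real r) = of_real r"
  by (rule emb_eqI, simp add: emb_sc_cnj)

lemma sc_Re_sc_cnj [simp]: "sc_Re (sc_cnj a) = sc_Re a"
  by (simp add: sc_Re_def emb_sc_cnj)

lemma norm_sc_cnj [simp]: "norm (sc_cnj a) = norm a"
  by (metis complex_mod_cnj emb_sc_cnj norm_emb)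

lemma sc_Re_mult_sc_cnj_le: "sc_Re (a * sc_cnj b) \<le> norm a * norm b"
  using sc_Re_le_norm[of "a * sc_cnj b"] by (simp add: norm_mult)

lemma mult_sc_cnj: "a * sc_cnj a = of_real ((norm a)\<^sup>2)"
  using complex_norm_square[of "emb a"]
  by - (rule emb_eqI, simp add: emb_sc_cnj emb_mult norm_emb
      del: of_real_power)

section \<open>Orthonormal expansions\<close>

context inner_product_space
begin

lemma ip_zero_left [simp]: "ip 0 y = 0"
  using ip_add_left[of 0 0 y] by simp

lemma ip_add_right: "ip x (y + z) = ip x y + ip x z"
  by (metis ip_add_left ip_conj sc_cnj_add)

lemma ip_scale_right: "ip x (scale a y) = sc_cnj a * ip x y"
  by (metis ip_scale_left ip_conj sc_cnj_mult)

lemma ip_diff_left: "ip (x - y) z = ip x z - ip y z"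
  using ip_add_left[of "x - y" y z] by (simp add: algebra_simps)

lemma ip_diff_right: "ip x (y - z) = ip x y - ip x z"
  using ip_add_right[of x "y - z" z] by (simp add: algebra_simps)

lemma ip_sum_left: "ip (sum f A) y = (\<Sum>i\<in>A. ip (f i) y)"
  by (induction A rule: infinite_finite_induct) (simp_all add: ip_add_left)

lemma sc_Re_ip_commute: "sc_Re (ip x y) = sc_Re (ip y x)"
  by (metis ip_conj sc_Re_sc_cnj)

lemma ip_norm_square: "(ip_norm ip x)\<^sup>2 = sc_Re (ip x x)"
  unfolding ip_norm_def using ip_ge_0[of x] by simp

lemma ip_norm_nonneg: "0 \<le> ip_norm ip x"
  unfolding ip_norm_def using ip_ge_0[of x] by simp

lemma ip_self: "ip x x = of_real ((ip_norm ip x)\<^sup>2)"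
proof -
  have "cnj (emb (ip x x)) = emb (ip x x)"
    by (metis emb_sc_cnj ip_conj)
  then have "emb (ip x x) = of_real (sc_Re (ip x x))"
    by (simp add: sc_Re_def complex_eq_iff)
  then show ?thesis
    by - (rule emb_eqI, simp add: ip_norm_square del: of_real_power)
qed

text \<open>The left-hand side is \<open>Re \<langle>u, v\<rangle>\<close> for \<open>u = a - x\<close>, \<open>v = x - b\<close>; here \<open>u + v = a - b\<close>, and
  \<open>v - u\<close> is twice the distance vector from \<open>x\<close> to the midpoint \<open>m\<close> of \<open>a\<close> and \<open>b\<close>.\<close>

lemma polarization:
  assumes "m + m = a + b"
  shows "sc_Re (ip (a - x) (x - b)) = (ip_norm ip (a - b))\<^sup>2 / 4 - (ip_norm ip (x - m))\<^sup>2"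
proof -
  have L: "sc_Re (ip m y) + sc_Re (ip m y) = sc_Re (ip a y) + sc_Re (ip b y)" for y
    by (metis assms ip_add_left sc_Re_add)
  show ?thesis
    unfolding ip_norm_square
    using L[of m] L[of a] L[of b] L[of x]
    by (simp add: ip_diff_left ip_diff_right sc_Re_diff
        sc_Re_ip_commute[of x a] sc_Re_ip_commute[of x b] sc_Re_ip_commute[of x m]
        sc_Re_ip_commute[of b a] sc_Re_ip_commute[of a m] sc_Re_ip_commute[of b m]) argo
qed

lemma ip_combination_left:
  "ip (\<Sum>i\<in>F. scale (a i) (e i)) y = (\<Sum>i\<in>F. a i * sc_cnj (ip y (e i)))"
  unfolding ip_sum_left by (rule sum.cong) (auto simp: ip_scale_left ip_conj[of "e _" y])

lemma ip_orthonormal_combination: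
  assumes e: "orthonormal_family ip I e" and F: "finite F" "F \<subseteq> I" and j: "j \<in> F"
  shows "ip (\<Sum>i\<in>F. scale (a i) (e i)) (e j) = a j"
proof -
  have "ip (\<Sum>i\<in>F. scale (a i) (e i)) (e j) = (\<Sum>i\<in>F. if i = j then a j else 0)"
    unfolding ip_sum_left
    using e F j by (intro sum.cong) (auto simp: ip_scale_left ip_self orthonormal_family_def)
  then show ?thesis using F j by simp
qed

lemma ip_norm_orthonormal_combination:
  assumes "orthonormal_family ip I e" "finite F" "F \<subseteq> I"
  shows "(ip_norm ip (\<Sum>i\<in>F. scale (a i) (e i)))\<^sup>2 = (\<Sum>i\<in>F. (norm (a i))\<^sup>2)"
  unfolding ip_norm_square
  by (subst ip_combination_left) (simp add: ip_orthonormal_combination[OF assms] mult_sc_cnj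
      sc_Re_sum del: of_real_power)

text \<open>The difference of the two sides is the squared norm of the component of \<open>x\<close> orthogonal to
  the vectors \<open>e\<^sub>i\<close> with \<open>i \<in> F\<close>.\<close>

lemma bessel_inequality:
  assumes "orthonormal_family ip I e" "finite F" "F \<subseteq> I"
  shows "(\<Sum>i\<in>F. (norm (ip x (e i)))\<^sup>2) \<le> (ip_norm ip x)\<^sup>2"
proof -
  let ?p = "\<Sum>i\<in>F. scale (ip x (e i)) (e i)"
  have "sc_Re (ip ?p x) = (\<Sum>i\<in>F. (norm (ip x (e i)))\<^sup>2)"
    by (simp add: ip_combination_left mult_sc_cnj sc_Re_sum del: of_real_power)
  moreover have "sc_Re (ip ?p ?p) = (\<Sum>i\<in>F. (norm (ip x (e i)))\<^sup>2)"
    using ip_norm_orthonormal_combination[OF assms] by (simp add: ip_norm_square)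
  moreover have "0 \<le> sc_Re (ip (x - ?p) (x - ?p))"
    by (rule ip_ge_0)
  ultimately show ?thesis
    by (simp add: ip_norm_square ip_diff_left ip_diff_right sc_Re_diff sc_Re_ip_commute[of x ?p])
qed

section \<open>The reverse of Bessel's inequality\<close>

lemma cond_inner_iff_cond_ball:
  assumes "orthonormal_family ip I e" "finite F" "F \<subseteq> I"
  shows "cond_inner scale ip e F \<Phi> \<phi> x \<longleftrightarrow> cond_ball scale ip e F \<Phi> \<phi> x"
proof -
  let ?A = "\<Sum>i\<in>F. scale (\<Phi> i) (e i)" and ?B = "\<Sum>i\<in>F. scale (\<phi> i) (e i)"
  let ?m = "\<Sum>i\<in>F. scale ((\<phi> i + \<Phi> i) / 2) (e i)"
  let ?r = "\<Sum>i\<in>F. (norm (\<Phi> i - \<phi> i))\<^sup>2"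
  have "?m + ?m = ?A + ?B"
    unfolding sum.distrib[symmetric] scale_left_distrib[symmetric]
    by (intro sum.cong) (auto simp: add.commute)
  note P = polarization[OF this, of x]
  have "?A - ?B = (\<Sum>i\<in>F. scale (\<Phi> i - \<phi> i) (e i))"
    by (simp add: sum_subtractf scale_left_diff_distrib)
  then have D: "(ip_norm ip (?A - ?B))\<^sup>2 = ?r"
    using ip_norm_orthonormal_combination[OF assms] by simp
  have r: "0 \<le> ?r" by (simp add: sum_nonneg)
  have "cond_inner scale ip e F \<Phi> \<phi> x \<longleftrightarrow> (ip_norm ip (x - ?m))\<^sup>2 \<le> (1 / 2 * sqrt ?r)\<^sup>2"
    unfolding cond_inner_def P D using r by (simp add: power_mult_distrib power_divide)
  also have "\<dots> \<longleftrightarrow> ip_norm ip (x - ?m) \<le> 1 / 2 * sqrt ?r"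
    by (rule abs_le_square_iff[symmetric, THEN trans])
       (use r ip_norm_nonneg in simp)
  finally show ?thesis unfolding cond_ball_def .
qed

text \<open>Orthonormality identifies \<open>S = \<Sum>Re (\<Phi>\<^sub>i cnj \<phi>\<^sub>i)\<close> with \<open>Re \<langle>A, B\<rangle>\<close> for the two combinations
  \<open>A\<close> and \<open>B\<close> in the condition on \<open>x\<close>.  Positivity of \<open>S\<close> makes \<open>\<parallel>x\<parallel>\<^sup>2 + S\<close> nonnegative, so that the inequality for it can
  be squared.\<close>

lemma four_mult_norm_le:
  assumes "orthonormal_family ip I e" "finite F" "F \<subseteq> I"
    and S: "(\<Sum>i\<in>F. sc_Re (\<Phi> i * sc_cnj (\<phi> i))) > 0"
    and x: "cond_inner scale ip e F \<Phi> \<phi> x"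
  shows "4 * (\<Sum>i\<in>F. sc_Re (\<Phi> i * sc_cnj (\<phi> i))) * (ip_norm ip x)\<^sup>2
    \<le> (\<Sum>i\<in>F. (norm (\<Phi> i) + norm (\<phi> i))\<^sup>2) * (\<Sum>i\<in>F. (norm (ip x (e i)))\<^sup>2)"
proof -
  let ?A = "\<Sum>i\<in>F. scale (\<Phi> i) (e i)" and ?B = "\<Sum>i\<in>F. scale (\<phi> i) (e i)"
  let ?S = "\<Sum>i\<in>F. sc_Re (\<Phi> i * sc_cnj (\<phi> i))" and ?X = "(ip_norm ip x)\<^sup>2"
  let ?T = "\<Sum>i\<in>F. (norm (\<Phi> i) + norm (\<phi> i)) * norm (ip x (e i))"
  have "sc_Re (ip ?A ?B) = ?S"
    by (subst ip_combination_left) (simp add: ip_orthonormal_combination[OF assms(1-3)] sc_Re_sum)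
  then have "?X + ?S \<le> sc_Re (ip ?A x) + sc_Re (ip ?B x)"
    using x by (simp add: cond_inner_def ip_norm_square ip_diff_left ip_diff_right sc_Re_diff
        sc_Re_ip_commute[of x ?B])
  also have "\<dots> = (\<Sum>i\<in>F. sc_Re (\<Phi> i * sc_cnj (ip x (e i))) + sc_Re (\<phi> i * sc_cnj (ip x (e i))))"
    by (simp add: ip_combination_left sc_Re_sum sum.distrib)
  also have "\<dots> \<le> ?T"
  proof (rule sum_mono)
    fix i
    show "sc_Re (\<Phi> i * sc_cnj (ip x (e i))) + sc_Re (\<phi> i * sc_cnj (ip x (e i)))
        \<le> (norm (\<Phi> i) + norm (\<phi> i)) * norm (ip x (e i))"
      by (simp add: distrib_right add_mono sc_Re_mult_sc_cnj_le)
  qed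
  finally have "(?X + ?S)\<^sup>2 \<le> ?T\<^sup>2"
    using S by (intro power_mono) auto
  moreover have "4 * ?S * ?X \<le> (?X + ?S)\<^sup>2"
    using zero_le_power2[of "?X - ?S"] by (simp add: power2_eq_square algebra_simps)
  moreover have "?T\<^sup>2 \<le> (\<Sum>i\<in>F. (norm (\<Phi> i) + norm (\<phi> i))\<^sup>2) * (\<Sum>i\<in>F. (norm (ip x (e i)))\<^sup>2)"
    by (rule Cauchy_Schwarz_ineq_sum)
  ultimately show ?thesis by linarith
qed

end

text \<open>For each \<open>i\<close>, \<open>(\<bar>\<Phi>\<^sub>i\<bar> - \<bar>\<phi>\<^sub>i\<bar>)\<^sup>2 + 4 \<bar>\<Phi>\<^sub>i cnj \<phi>\<^sub>i\<bar> = (\<bar>\<Phi>\<^sub>i\<bar> + \<bar>\<phi>\<^sub>i\<bar>)\<^sup>2\<close>.  The radicand of \<open>M\<close> is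
  nonnegative because \<open>Re z \<le> \<bar>z\<bar>\<close>, so squaring removes the root.\<close>

lemma bessel_M_square:
  assumes S: "(\<Sum>i\<in>F. sc_Re (\<Phi> i * sc_cnj (\<phi> i))) > 0"
  shows "(bessel_M \<Phi> \<phi> F)\<^sup>2
    = (\<Sum>i\<in>F. (norm (\<Phi> i) + norm (\<phi> i))\<^sup>2) / (\<Sum>i\<in>F. sc_Re (\<Phi> i * sc_cnj (\<phi> i))) - 4"
proof -
  let ?S = "\<Sum>i\<in>F. sc_Re (\<Phi> i * sc_cnj (\<phi> i))"
  let ?N = "\<Sum>i\<in>F. (norm (\<Phi> i) - norm (\<phi> i))\<^sup>2
    + 4 * (norm (\<Phi> i * sc_cnj (\<phi> i)) - sc_Re (\<Phi> i * sc_cnj (\<phi> i)))"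
  have "0 \<le> ?N"
    by (intro sum_nonneg add_nonneg_nonneg) (simp_all add: sc_Re_le_norm)
  then have "(bessel_M \<Phi> \<phi> F)\<^sup>2 = ?N / ?S"
    unfolding bessel_M_def using S by simp
  also have "?N = (\<Sum>i\<in>F. (norm (\<Phi> i) + norm (\<phi> i))\<^sup>2 - 4 * sc_Re (\<Phi> i * sc_cnj (\<phi> i)))"
    by (intro sum.cong) (auto simp: norm_mult power2_eq_square algebra_simps)
  also have "\<dots> = (\<Sum>i\<in>F. (norm (\<Phi> i) + norm (\<phi> i))\<^sup>2) - 4 * ?S"
    by (simp add: sum_subtractf sum_distrib_left)
  finally show ?thesis
    using S by (simp add: diff_divide_distrib)
qed

lemma (in inner_product_space) reverse_bessel_inequality:
  assumes "orthonormal_family ip I e" "finite F" "F \<subseteq> I"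
    and S: "(\<Sum>i\<in>F. sc_Re (\<Phi> i * sc_cnj (\<phi> i))) > 0"
    and "cond_inner scale ip e F \<Phi> \<phi> x"
  shows "(ip_norm ip x)\<^sup>2 - (\<Sum>i\<in>F. (norm (ip x (e i)))\<^sup>2)
    \<le> 1 / 4 * (bessel_M \<Phi> \<phi> F)\<^sup>2 * (\<Sum>i\<in>F. (norm (ip x (e i)))\<^sup>2)"
  using four_mult_norm_le[OF assms] S
  by (simp add: bessel_M_square[OF S] field_simps)

section \<open>Equality in the plane\<close>

definition plane_scale :: "'k::real_or_complex \<Rightarrow> 'k \<times> 'k \<Rightarrow> 'k \<times> 'k" where
  "plane_scale a u = (a * fst u, a * snd u)"

definition plane_ip :: "'k::real_or_complex \<times> 'k \<Rightarrow> 'k \<times> 'k \<Rightarrow> 'k" where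
  "plane_ip u v = fst u * sc_cnj (fst v) + snd u * sc_cnj (snd v)"

lemma plane_ip_self: "plane_ip u u = of_real ((norm (fst u))\<^sup>2 + (norm (snd u))\<^sup>2)"
  by (simp only: plane_ip_def mult_sc_cnj of_real_add)

lemma inner_product_space_plane:
  "inner_product_space (plane_scale :: 'k::real_or_complex \<Rightarrow> _) plane_ip"
proof
  show "plane_ip y x = sc_cnj (plane_ip x y)" for x y :: "'k \<times> 'k"
    by (simp add: plane_ip_def sc_cnj_add sc_cnj_mult mult.commute)
  show "0 \<le> sc_Re (plane_ip x x)" for x :: "'k \<times> 'k"
    unfolding plane_ip_self sc_Re_of_real by simp
  show "plane_ip x x = 0 \<longleftrightarrow> x = 0" for x :: "'k \<times> 'k"
    unfolding plane_ip_self of_real_eq_0_iff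
    by (simp add: add_nonneg_eq_0_iff prod_eq_iff)
qed (simp_all add: plane_scale_def plane_ip_def algebra_simps prod_eq_iff)

text \<open>The extremal example has real coordinates; these equations keep every
  coordinate in the form \<open>of_real r\<close>, so that all arithmetic is done in the reals.\<close>

lemma plane_real_points:
  fixes a b c d s :: real
  shows "plane_ip (of_real a, of_real b) (of_real c, of_real d) = of_real (a * c + b * d)"
    and "plane_scale (of_real s) (of_real a, of_real b) = (of_real (s * a), of_real (s * b))"
    and "(of_real a, of_real b) - (of_real c, of_real d) = (of_real (a - c), of_real (b - d))"
  by (simp_all add: plane_ip_def plane_scale_def)

lemma sum_singleton: "sum f {a} = f a"
  by simp

text \<open>Both sides of the upper bound are \<open>36/25\<close> here: \<open>4 - 64/25 = 1/4 * 9/4 * 64/25\<close>.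
  The point \<open>x\<close> lies on the circle with the segment from \<open>(1, 0)\<close> to \<open>(4, 0)\<close> as diameter.\<close>

lemma plane_equality_case:
  defines "x \<equiv> (of_real (8/5), of_real (6/5)) :: 'k::real_or_complex \<times> 'k"
    and "e \<equiv> (\<lambda>_::nat. (of_real 1, of_real 0)) :: nat \<Rightarrow> 'k \<times> 'k"
    and "\<Phi> \<equiv> (\<lambda>_::nat. of_real 4) :: nat \<Rightarrow> 'k"
    and "\<phi> \<equiv> (\<lambda>_::nat. of_real 1) :: nat \<Rightarrow> 'k"
  shows "orthonormal_family plane_ip {0} e"
    and "(\<Sum>i\<in>{0}. sc_Re (\<Phi> i * sc_cnj (\<phi> i))) = 4"
    and "cond_inner plane_scale plane_ip e {0} \<Phi> \<phi> x"
    and "(ip_norm plane_ip x)\<^sup>2 = 4"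
    and "(\<Sum>i\<in>{0}. (norm (plane_ip x (e i)))\<^sup>2) = 64/25"
    and "(bessel_M \<Phi> \<phi> {0})\<^sup>2 = 9/4"
proof -
  have "ip_norm plane_ip (e 0) = 1"
    unfolding ip_norm_def e_def plane_real_points sc_Re_of_real by simp
  then show "orthonormal_family plane_ip {0} e"
    by (simp add: orthonormal_family_def)
  show S: "(\<Sum>i\<in>{0}. sc_Re (\<Phi> i * sc_cnj (\<phi> i))) = 4"
    unfolding sum_singleton \<Phi>_def \<phi>_def sc_cnj_of_real of_real_mult[symmetric] sc_Re_of_real by simp
  show "cond_inner plane_scale plane_ip e {0} \<Phi> \<phi> x"
    unfolding cond_inner_def sum_singleton x_def e_def \<Phi>_def \<phi>_def plane_real_points sc_Re_of_real
    by simp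
  show "(ip_norm plane_ip x)\<^sup>2 = 4"
    unfolding inner_product_space.ip_norm_square[OF inner_product_space_plane]
      x_def plane_real_points sc_Re_of_real
    by simp
  show "(\<Sum>i\<in>{0}. (norm (plane_ip x (e i)))\<^sup>2) = 64/25"
    unfolding sum_singleton x_def e_def plane_real_points norm_of_real by (simp add: power2_eq_square)
  have "(\<Sum>i\<in>{0}. sc_Re (\<Phi> i * sc_cnj (\<phi> i))) > 0" unfolding S by simp
  from bessel_M_square[OF this, unfolded S] show "(bessel_M \<Phi> \<phi> {0})\<^sup>2 = 9/4"
    unfolding sum_singleton \<Phi>_def \<phi>_def norm_of_real by simp
qed

theorem corollary1:
  fixes scale :: "'k::real_or_complex \<Rightarrow> 'v::ab_group_add \<Rightarrow> 'v"
    and ip :: "'v \<Rightarrow> 'v \<Rightarrow> 'k"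
    and I F :: "'i set"
    and e :: "'i \<Rightarrow> 'v"
    and \<Phi> \<phi> :: "'i \<Rightarrow> 'k"
    and x :: 'v
  shows
    "(inner_product_space scale ip \<and> orthonormal_family ip I e \<and> finite F \<and> F \<subseteq> I
       \<and> (\<Sum>i\<in>F. sc_Re (\<Phi> i * sc_cnj (\<phi> i))) > 0
       \<longrightarrow> (cond_inner scale ip e F \<Phi> \<phi> x \<longleftrightarrow> cond_ball scale ip e F \<Phi> \<phi> x)
         \<and> (cond_inner scale ip e F \<Phi> \<phi> x \<or> cond_ball scale ip e F \<Phi> \<phi> x
            \<longrightarrow> 0 \<le> (ip_norm ip x)\<^sup>2 - (\<Sum>i\<in>F. (norm (ip x (e i)))\<^sup>2)
              \<and> (ip_norm ip x)\<^sup>2 - (\<Sum>i\<in>F. (norm (ip x (e i)))\<^sup>2)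
                  \<le> 1 / 4 * (bessel_M \<Phi> \<phi> F)\<^sup>2 * (\<Sum>i\<in>F. (norm (ip x (e i)))\<^sup>2)))
     \<and> \<not> (\<exists>c < 1 / 4 :: real.
            \<forall>(scale' :: 'k \<Rightarrow> 'k \<times> 'k \<Rightarrow> 'k \<times> 'k) (ip' :: 'k \<times> 'k \<Rightarrow> 'k \<times> 'k \<Rightarrow> 'k)
              (I' :: nat set) (e' :: nat \<Rightarrow> 'k \<times> 'k) (F' :: nat set)
              (\<Phi>' :: nat \<Rightarrow> 'k) (\<phi>' :: nat \<Rightarrow> 'k) (x' :: 'k \<times> 'k).
              inner_product_space scale' ip' \<and> orthonormal_family ip' I' e'
              \<and> finite F' \<and> F' \<subseteq> I' \<and> (\<Sum>i\<in>F'. sc_Re (\<Phi>' i * sc_cnj (\<phi>' i))) > 0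
              \<and> (cond_inner scale' ip' e' F' \<Phi>' \<phi>' x' \<or> cond_ball scale' ip' e' F' \<Phi>' \<phi>' x')
              \<longrightarrow> (ip_norm ip' x')\<^sup>2 - (\<Sum>i\<in>F'. (norm (ip' x' (e' i)))\<^sup>2)
                    \<le> c * (bessel_M \<Phi>' \<phi>' F')\<^sup>2 * (\<Sum>i\<in>F'. (norm (ip' x' (e' i)))\<^sup>2))"
proof (intro conjI impI, goal_cases)
  case 1
  then interpret inner_product_space scale ip by blast
  from 1 show ?case by (intro cond_inner_iff_cond_ball) auto
next
  case 2
  then interpret inner_product_space scale ip by blast
  from 2 show ?case using bessel_inequality[of I e F x] by simp
next
  case 3
  then interpret inner_product_space scale ip by blast
  from 3 show ?case
    by (intro reverse_bessel_inequality) (auto simp: cond_inner_iff_cond_ball)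
next
  case 4
  show ?case
  proof (rule notI, elim exE conjE, goal_cases)
    case (1 c)
    let ?e = "\<lambda>_::nat. (of_real 1, of_real 0) :: 'k \<times> 'k"
    let ?\<Phi> = "\<lambda>_::nat. of_real 4 :: 'k" and ?\<phi> = "\<lambda>_::nat. of_real 1 :: 'k"
    let ?x = "(of_real (8/5), of_real (6/5)) :: 'k \<times> 'k"
    note eq = plane_equality_case[where 'k = 'k]
    have "(\<Sum>i\<in>{0}. sc_Re (?\<Phi> i * sc_cnj (?\<phi> i))) > 0"
      unfolding eq(2) by simp
    with eq(1,3) have "(ip_norm plane_ip ?x)\<^sup>2 - (\<Sum>i\<in>{0}. (norm (plane_ip ?x (?e i)))\<^sup>2)
        \<le> c * (bessel_M ?\<Phi> ?\<phi> {0})\<^sup>2 * (\<Sum>i\<in>{0}. (norm (plane_ip ?x (?e i)))\<^sup>2)"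
      by (intro 1(2)[rule_format, of plane_scale plane_ip "{0}" ?e "{0}" ?\<Phi> ?\<phi> ?x] conjI disjI1
          inner_product_space_plane) (assumption | simp)+
    then have "4 - 64/25 \<le> c * (9/4) * (64/25)"
      unfolding eq(4-6) .
    then show False using 1(1) by simp
  qed
qed

end
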